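(* Let $a\in(0,2]$ and suppose that the critical orbit of $f_a$ is pre-periodic to an unstable periodic orbit $\{x_1,x_2,\ldots,x_p\}$. Then there is a sequence of parameters $\{a_n\}_{n=1}^\infty\subset(0,2]$ converging to $a$ such that each $f_{a_n}$ has a super-stable periodic attractor and, in the weak* topology, $$\mu_{a_n}\longrightarrow\mu_a^{\mathrm{sing}}:=\frac1p\sum_{i=1}^p\delta_{x_i}\quad\text{as } n\to\infty .$$
   Context: The quadratic family is $f_a(x)=1-ax^2$, $0<a\le 2$, acting on $I=[-1,1]$; its critical point is $0$. The critical orbit is pre-periodic to the periodic orbit $\{x_1,\dots,x_p\}$ (of period $p$) if $f_a^N(0)\in\{x_1,\dots,x_p\}$ for some $N\ge1$; the periodic orbit is unstable if $|Df_a^p(x_1)|>1$. A super-stable periodic attractor of $f_b$ is a periodic orbit containing the critical point $0$. If $f_b$ has a periodic attractor $\{y_1,\dots,y_q\}$ of period $q$, then $\mu_b=\frac1q\sum_{i=1}^q\delta_{y_i}$ is its natural measure, describing the asymptotic distribution of Lebesgue almost all orbits. *)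

theory Defs
  imports "HOL-Probability.Probability"
begin

abbreviation I :: "real set" where
  "I \<equiv> {-1..1}"

definition quad :: "real \<Rightarrow> real \<Rightarrow> real" where
  "quad a x = 1 - a * x\<^sup>2"

(* The cycle is listed as x 1, ..., x p in the order in which it is traversed; values of x outside
   {1..p} are irrelevant. Distinctness of the points makes p the minimal period. *)
definition periodic_orbit :: "real \<Rightarrow> nat \<Rightarrow> (nat \<Rightarrow> real) \<Rightarrow> bool" where
  "periodic_orbit a p x \<longleftrightarrow>
     1 \<le> p \<and> (\<forall>i\<in>{1..p}. x i \<in> I) \<and> inj_on x {1..p} \<and>
     (\<forall>i\<in>{1..<p}. quad a (x i) = x (Suc i)) \<and> quad a (x p) = x 1"

definition unstable_periodic_orbit :: "real \<Rightarrow> nat \<Rightarrow> (nat \<Rightarrow> real) \<Rightarrow> bool" where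
  "unstable_periodic_orbit a p x \<longleftrightarrow>
     periodic_orbit a p x \<and> \<bar>deriv (quad a ^^ p) (x 1)\<bar> > 1"

definition superstable_attractor :: "real \<Rightarrow> nat \<Rightarrow> (nat \<Rightarrow> real) \<Rightarrow> bool" where
  "superstable_attractor b q y \<longleftrightarrow> periodic_orbit b q y \<and> 0 \<in> y ` {1..q}"

definition critical_orbit_preperiodic_to :: "real \<Rightarrow> nat \<Rightarrow> (nat \<Rightarrow> real) \<Rightarrow> bool" where
  "critical_orbit_preperiodic_to a p x \<longleftrightarrow> (\<exists>N\<ge>1. (quad a ^^ N) 0 \<in> x ` {1..p})"

abbreviation borel_I :: "real measure" where
  "borel_I \<equiv> restrict_space borel I"

(* The measure (1/p) (delta_{x 1} + ... + delta_{x p}) on the Borel sets of I. *)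
definition orbit_measure :: "nat \<Rightarrow> (nat \<Rightarrow> real) \<Rightarrow> real measure" where
  "orbit_measure p x =
     measure_of I (sets borel_I) (\<lambda>A. (\<Sum>i=1..p. emeasure (return borel_I (x i)) A) / of_nat p)"

(* Convergence in the weak* topology on the dual of C(I), for Borel measures on I. *)
definition weak_star_conv :: "(nat \<Rightarrow> real measure) \<Rightarrow> real measure \<Rightarrow> bool" where
  "weak_star_conv M L \<longleftrightarrow>
     (\<forall>\<phi>::real \<Rightarrow> real. continuous_on I \<phi> \<longrightarrow>
        (\<lambda>n. integral\<^sup>L (M n) \<phi>) \<longlonglongrightarrow> integral\<^sup>L L \<phi>)"

lemma space_orbit_measure [simp]: "space (orbit_measure p x) = I"
  unfolding orbit_measure_def
  using sets.space_closed[of borel_I] by (simp add: space_measure_of space_restrict_space)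

lemma sets_orbit_measure [simp, measurable_cong]: "sets (orbit_measure p x) = sets borel_I"
  unfolding orbit_measure_def
  using sets.sets_measure_of_eq[of borel_I] by (simp add: space_restrict_space)

(* measure_of yields the null measure when the given set function is not a measure; the next
   lemma shows that this does not happen here. *)
lemma emeasure_orbit_measure:
  assumes "A \<in> sets borel_I"
  shows "emeasure (orbit_measure p x) A =
    (\<Sum>i=1..p. emeasure (return borel_I (x i)) A) / of_nat p"
proof (rule emeasure_measure_of[OF orbit_measure_def])
  show "sets borel_I \<subseteq> Pow I"
    using sets.space_closed[of borel_I] by (simp add: space_restrict_space)
  show "A \<in> sets (orbit_measure p x)" using assms by simp
  let ?g = "\<lambda>A. (\<Sum>i=1..p. emeasure (return borel_I (x i)) A) / of_nat p"
  show "positive (sets (orbit_measure p x)) ?g"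
    by (simp add: positive_def)
  show "countably_additive (sets (orbit_measure p x)) ?g"
  proof (rule countably_additiveI)
    fix F :: "nat \<Rightarrow> real set"
    assume F: "range F \<subseteq> sets (orbit_measure p x)" "disjoint_family F"
    have "(\<Sum>n. emeasure (return borel_I (x i)) (F n)) = emeasure (return borel_I (x i)) (\<Union>n. F n)"
      for i using F by (intro suminf_emeasure) simp_all
    then show "(\<Sum>n. ?g (F n)) = ?g (\<Union>n. F n)"
      by (simp add: divide_ennreal_def suminf_sum)
  qed
qed

lemma periodic_orbit_image_eq:
  assumes P: "periodic_orbit b q y" and i: "i \<in> {1..q}"
  shows "y ` {1..q} = range (\<lambda>n. (quad b ^^ n) (y i))"
proof -
  have q: "1 \<le> q" and last: "quad b (y q) = y 1"
    and step: "\<And>k. 1 \<le> k \<Longrightarrow> k < q \<Longrightarrow> quad b (y k) = y (Suc k)"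
    using P by (auto simp: periodic_orbit_def)
  have closed: "quad b z \<in> y ` {1..q}" if "z \<in> y ` {1..q}" for z
  proof -
    from that obtain k where z: "z = y k" and k: "k \<in> {1..q}" by (rule imageE)
    show ?thesis
    proof (cases "k = q")
      case True
      then show ?thesis unfolding z using last q by (intro image_eqI[where x = 1]) simp_all
    next
      case False
      then show ?thesis unfolding z using step[of k] k by (intro image_eqI[where x = "Suc k"]) simp_all
    qed
  qed
  have run: "(quad b ^^ m) (y k) = y (k + m)" if "1 \<le> k" "k + m \<le> q" for k m
    using that
  proof (induction m)
    case (Suc m)
    then show ?case using step[of "k + m"] by simp
  qed simp
  have fwd: "(quad b ^^ n) (y i) \<in> y ` {1..q}" for n
  proof (induction n)
    case 0
    then show ?case using i by simp
  next
    case (Suc n)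
    then show ?case using closed by simp
  qed
  have bwd: "y j \<in> range (\<lambda>n. (quad b ^^ n) (y i))" if j: "j \<in> {1..q}" for j
  proof -
    have "(quad b ^^ (j - 1)) (quad b ((quad b ^^ (q - i)) (y i))) = y j"
      using i j run[of i "q - i"] run[of 1 "j - 1"] last by simp
    then have "(quad b ^^ (j - 1 + Suc (q - i))) (y i) = y j"
      by (simp only: funpow_add funpow.simps comp_apply)
    then show ?thesis
      by (intro image_eqI[where x = "j - 1 + Suc (q - i)"]) (rule sym, assumption, rule UNIV_I)
  qed
  show ?thesis
  proof (rule subset_antisym)
    show "y ` {1..q} \<subseteq> range (\<lambda>n. (quad b ^^ n) (y i))"
      by (rule image_subsetI) (rule bwd)
    show "range (\<lambda>n. (quad b ^^ n) (y i)) \<subseteq> y ` {1..q}"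
      by (rule image_subsetI) (rule fwd)
  qed
qed

lemma orbit_measure_cong_image:
  assumes "inj_on x {1..p}" and "inj_on y {1..q}" and "x ` {1..p} = y ` {1..q}"
  shows "orbit_measure p x = orbit_measure q y"
proof -
  have "p = q" using assms card_image[of x "{1..p}"] card_image[of y "{1..q}"] by simp
  moreover have "(\<Sum>i=1..p. emeasure (return borel_I (x i)) A)
      = (\<Sum>i=1..q. emeasure (return borel_I (y i)) A)" for A
    using sum.reindex[OF assms(1), of "\<lambda>z. emeasure (return borel_I z) A"]
      sum.reindex[OF assms(2), of "\<lambda>z. emeasure (return borel_I z) A"] assms(3)
    by simp
  ultimately show ?thesis by (simp only: orbit_measure_def)
qed

(* The natural measure of a map with a super-stable attractor depends on b only. *)
lemma superstable_orbit_measure_unique: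
  assumes "superstable_attractor b q y" and "superstable_attractor b q' y'"
  shows "orbit_measure q y = orbit_measure q' y'"
proof (rule orbit_measure_cong_image)
  have "y ` {1..q} = range (\<lambda>n. (quad b ^^ n) 0)" if y: "superstable_attractor b q y" for q y
  proof -
    obtain i where "i \<in> {1..q}" "y i = 0"
      using y unfolding superstable_attractor_def by (auto simp del: One_nat_def)
    then show ?thesis
      using y periodic_orbit_image_eq[of b q y i] by (simp add: superstable_attractor_def)
  qed
  then show "y ` {1..q} = y' ` {1..q'}" using assms by simp
qed (use assms in \<open>simp_all add: superstable_attractor_def periodic_orbit_def\<close>)

end

theory Submission
  imports Defs
begin

text \<open>
  Let \<open>z\<close> be the point of the unstable cycle that the critical orbit of \<open>quad a\<close> hits at time \<open>N\<close>, and
  let \<open>P\<close> be a multiple of the period. Parameter transversality is not needed: since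
  \<open>(quad b ^^ N) 0\<close> and \<open>(quad b ^^ (N + P)) 0\<close> are different polynomials in \<open>b\<close>, they differ for all
  \<open>b \<noteq> a\<close> near \<open>a\<close>, and so the points \<open>(quad b ^^ (N + j * P)) 0\<close>, which stay near \<open>z\<close> for a long time, are
  finally driven away from \<open>z\<close> by the expansion. By continuity in \<open>b\<close>, at a suitable time these points
  sweep, as \<open>b\<close> varies arbitrarily close to \<open>a\<close>, a one-sided neighbourhood of \<open>z\<close> of fixed size. Some
  iterate of \<open>quad a\<close> changes sign there, so for some of these \<open>b\<close> the critical orbit returns to \<open>0\<close>
  after having spent most of its time near the cycle.

  The sign change is obtained as follows. The critical orbit of \<open>quad a\<close> being finite, \<open>quad a\<close> strictly
  expands the hyperbolic metric of its complement, so every periodic point of \<open>quad a\<close> in \<open>I\<close> is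
  repelling. If no iterate changed sign next to \<open>z\<close>, then all iterates of \<open>quad a ^^ P\<close> would be
  increasing there, and the orbit of a point close to \<open>z\<close> would converge monotonically to a fixed point,
  which cannot be repelling.
\<close>

subsection \<open>Iterates of the quadratic family\<close>

lemma quad_in_I:
  assumes "0 \<le> b" "b \<le> 2" "t \<in> I"
  shows "quad b t \<in> I"
proof -
  have "t\<^sup>2 \<le> 1" using assms(3) by (simp add: abs_square_le_1 abs_le_iff)
  then have "b * t\<^sup>2 \<le> 2 * 1" using assms by (intro mult_mono) auto
  moreover have "0 \<le> b * t\<^sup>2" using assms by simp
  ultimately show ?thesis by (simp add: quad_def)
qed

lemma quad_funpow_in_I:
  assumes "0 \<le> b" "b \<le> 2" "t \<in> I"
  shows "(quad b ^^ n) t \<in> I"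
proof (induction n)
  case (Suc n)
  then show ?case using quad_in_I[OF assms(1,2)] by simp
qed (use assms in simp)

lemma quad_funpow_add: "(quad b ^^ (m + n)) t = (quad b ^^ m) ((quad b ^^ n) t)"
  by (simp add: funpow_add)

lemma tendsto_quad_funpow [tendsto_intros]:
  assumes "(u \<longlongrightarrow> b) F" "(v \<longlongrightarrow> t) F"
  shows "((\<lambda>s. (quad (u s) ^^ n) (v s)) \<longlongrightarrow> (quad b ^^ n) t) F"
  by (induction n) (auto simp: quad_def intro!: tendsto_intros assms)

lemma continuous_on_quad_funpow [continuous_intros]:
  assumes "continuous_on S u" "continuous_on S v"
  shows "continuous_on S (\<lambda>s. (quad (u s) ^^ n) (v s))"
  using assms by (auto simp: continuous_on_def intro!: tendsto_intros)

text \<open>The chain-rule product along the orbit. This form makes joint continuity in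
  \<open>b\<close> and \<open>t\<close> immediate and shows that, for \<open>b\<close> nonzero, the
  derivative vanishes exactly if the orbit meets 0 before time \<open>n\<close>.\<close>

definition dquad :: "real \<Rightarrow> nat \<Rightarrow> real \<Rightarrow> real" where
  "dquad b n t = (\<Prod>i<n. -2 * b * (quad b ^^ i) t)"

lemma DERIV_quad_funpow: "((quad b ^^ n) has_real_derivative dquad b n t) (at t)"
proof (induction n)
  case (Suc n)
  have "((\<lambda>t. 1 - b * ((quad b ^^ n) t)\<^sup>2) has_real_derivative dquad b (Suc n) t) (at t)"
    by (rule derivative_eq_intros Suc refl)+ (simp add: dquad_def)
  then show ?case by (simp add: quad_def[abs_def] comp_def)
qed (simp add: dquad_def)

lemma dquad_add: "dquad b (m + n) t = dquad b m ((quad b ^^ n) t) * dquad b n t"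
proof (induction m)
  case (Suc m)
  then show ?case by (simp add: dquad_def quad_funpow_add mult_ac)
qed (simp add: dquad_def)

lemma tendsto_dquad [tendsto_intros]:
  assumes "(u \<longlongrightarrow> b) F" "(v \<longlongrightarrow> t) F"
  shows "((\<lambda>s. dquad (u s) n (v s)) \<longlongrightarrow> dquad b n t) F"
  unfolding dquad_def by (intro tendsto_intros assms)

lemma quad_funpow_periodic:
  assumes "(quad b ^^ n) t = t"
  shows "(quad b ^^ (k * n)) t = t"
proof (induction k)
  case (Suc k)
  then show ?case using assms by (simp add: quad_funpow_add)
qed simp

lemma dquad_periodic:
  assumes "(quad b ^^ n) t = t"
  shows "dquad b (k * n) t = dquad b n t ^ k"
proof (induction k)
  case (Suc k)
  then show ?case using assms dquad_add[of b "k * n" n t] by (simp add: add.commute mult.commute)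
qed (simp add: dquad_def)

subsection \<open>Expansion of the hyperbolic metric\<close>

text \<open>The density, up to a constant factor, of the hyperbolic metric of the component of the complement
  of \<open>A\<close> that contains \<open>x\<close>. It is meaningful only if \<open>A\<close> has points on both sides of \<open>x\<close>, since
  otherwise \<open>Max\<close> or \<open>Min\<close> is applied to the empty set.\<close>

definition hyp_density :: "real set \<Rightarrow> real \<Rightarrow> real" where
  "hyp_density A x = 1 / (x - Max {c \<in> A. c < x}) + 1 / (Min {c \<in> A. x < c} - x)"

text \<open>The component of \<open>x\<close> in the complement of \<open>A\<close> lies between
  \<open>l\<close> and \<open>r\<close>, and shrinking an interval increases its density.\<close>

lemma hyp_density_ge:
  assumes "finite A" "l \<in> A" "r \<in> A" "l < x" "x < r"
  shows "1 / (x - l) + 1 / (r - x) \<le> hyp_density A x"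
proof -
  have "l \<le> Max {c \<in> A. c < x}" using assms by (intro Max_ge) auto
  moreover have "Max {c \<in> A. c < x} \<in> {c \<in> A. c < x}" by (rule Max_in) (use assms in auto)
  moreover have "Min {c \<in> A. x < c} \<le> r" using assms by (intro Min_le) auto
  moreover have "Min {c \<in> A. x < c} \<in> {c \<in> A. x < c}" by (rule Min_in) (use assms in auto)
  ultimately show ?thesis
    unfolding hyp_density_def by (intro add_mono frac_le) auto
qed

text \<open>The component of \<open>x\<close> avoids 0, so \<open>quad a\<close> is injective on it
  and sends its end points into \<open>A\<close>. Hence the component of \<open>quad a x\<close>
  lies inside the image, and it suffices to compare with the density of the image.\<close>

lemma hyp_density_quad_less:
  assumes A: "finite A" "0 \<in> A" "quad a ` A \<subseteq> A" and a: "0 < a"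
    and x: "x \<notin> A" "lo \<in> A" "hi \<in> A" "lo < x" "x < hi"
  shows "hyp_density A x < hyp_density A (quad a x) * \<bar>2 * a * x\<bar>"
proof -
  define l r where "l = Max {c \<in> A. c < x}" and "r = Min {c \<in> A. x < c}"
  have "l \<in> {c \<in> A. c < x}" unfolding l_def by (rule Max_in) (use A x in auto)
  then have l: "l \<in> A" "l < x" by auto
  have "r \<in> {c \<in> A. x < c}" unfolding r_def by (rule Min_in) (use A x in auto)
  then have r: "r \<in> A" "x < r" by auto
  have fA: "quad a l \<in> A" "quad a r \<in> A" using l r A by auto
  have D: "hyp_density A x = 1 / (x - l) + 1 / (r - x)"
    by (simp add: hyp_density_def l_def r_def)
  have "x \<noteq> 0" using A x by auto
  then consider "0 < x" | "x < 0" by linarith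
  then show ?thesis
  proof cases
    case 1
    then have l0: "0 \<le> l" using A unfolding l_def by (auto intro!: Max_ge)
    have sq: "l\<^sup>2 < x\<^sup>2" "x\<^sup>2 < r\<^sup>2" using l l0 r 1 by (auto intro!: power_strict_mono)
    have "1 / (quad a x - quad a r) + 1 / (quad a l - quad a x) \<le> hyp_density A (quad a x)"
      using sq a by (intro hyp_density_ge A fA) (auto simp: quad_def)
    moreover have "1 / (quad a x - quad a r) * (2 * a * x) = 1 / (r - x) - 1 / (r + x)"
    proof -
      have e: "quad a x - quad a r = a * ((r - x) * (r + x))"
        by (simp add: quad_def algebra_simps power2_eq_square)
      show ?thesis unfolding e using a 1 r by (simp add: divide_simps)
    qed
    moreover have "1 / (quad a l - quad a x) * (2 * a * x) = 1 / (x - l) + 1 / (x + l)"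
    proof -
      have e: "quad a l - quad a x = a * ((x - l) * (x + l))"
        by (simp add: quad_def algebra_simps power2_eq_square)
      show ?thesis unfolding e using a 1 l l0 by (simp add: divide_simps)
    qed
    \<comment> \<open>Partial fractions have produced the two terms of \<open>D\<close> and the
      surplus 1/(x + l) - 1/(r + x), which is positive because \<open>l\<close> <
      \<open>r\<close>.\<close>
    moreover have "1 / (r + x) < 1 / (x + l)" using 1 l l0 r by (intro divide_strict_left_mono) auto
    moreover have "0 < 2 * a * x" using 1 a by simp
    ultimately show ?thesis unfolding D
      by (smt (verit, ccfv_SIG) distrib_right mult_right_mono)
  next
    case 2
    then have r0: "r \<le> 0" using A unfolding r_def by (auto intro!: Min_le)
    have "(-r)\<^sup>2 < (-x)\<^sup>2" "(-x)\<^sup>2 < (-l)\<^sup>2" using l r0 r 2 by (intro power_strict_mono; simp)+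
    then have sq: "r\<^sup>2 < x\<^sup>2" "x\<^sup>2 < l\<^sup>2" by simp_all
    have "1 / (quad a x - quad a l) + 1 / (quad a r - quad a x) \<le> hyp_density A (quad a x)"
      using sq a by (intro hyp_density_ge A fA) (auto simp: quad_def)
    moreover have "1 / (quad a x - quad a l) * (- (2 * a * x)) = 1 / (x - l) - 1 / (- x - l)"
    proof -
      have e: "quad a x - quad a l = a * ((x - l) * (- x - l))"
        by (simp add: quad_def algebra_simps power2_eq_square)
      show ?thesis unfolding e using a 2 l by (simp add: divide_simps)
    qed
    moreover have "1 / (quad a r - quad a x) * (- (2 * a * x)) = 1 / (r - x) + 1 / (- x - r)"
    proof -
      have e: "quad a r - quad a x = a * ((r - x) * (- x - r))"
        by (simp add: quad_def algebra_simps power2_eq_square)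
      show ?thesis unfolding e using a 2 r r0 by (simp add: divide_simps)
    qed
    moreover have "1 / (- x - l) < 1 / (- x - r)" using 2 l r0 r by (intro divide_strict_left_mono) (auto intro: mult_pos_pos)
    moreover have "0 < - (2 * a * x)" using 2 a by (simp add: mult_pos_neg)
    moreover have "\<bar>2 * a * x\<bar> = - (2 * a * x)" using calculation by linarith
    ultimately show ?thesis unfolding D
      by (smt (verit, ccfv_SIG) distrib_right mult_right_mono)
  qed
qed

subsection \<open>Pre-periodic critical orbits\<close>

text \<open>A point just to the right of \<open>z\<close> is pushed to the right, and its bounded
  increasing orbit converges to a fixed point that attracts from the left.\<close>

lemma nonrepelling_fixpoint_right:
  fixes g g' :: "real \<Rightarrow> real"
  assumes der: "\<And>t. (g has_real_derivative g' t) (at t)"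
    and z: "z < e" "g z = z" "g' z > 1"
    and mono: "\<And>k s t. z \<le> s \<Longrightarrow> s < t \<Longrightarrow> t < e \<Longrightarrow> (g ^^ k) s < (g ^^ k) t"
    and bound: "\<And>k t. z \<le> t \<Longrightarrow> t < e \<Longrightarrow> (g ^^ k) t \<in> {c..d}"
  shows "\<exists>w\<in>{c..d}. g w = w \<and> \<bar>g' w\<bar> \<le> 1"
proof -
  have cont: "isCont g t" for t using der DERIV_isCont by blast
  have "((\<lambda>t. g t - t) has_real_derivative g' z - 1) (at z)"
    by (rule derivative_eq_intros der refl)+
  then obtain h where h: "h > 0" "\<And>s. 0 < s \<Longrightarrow> s < h \<Longrightarrow> g z - z < g (z + s) - (z + s)"
    using DERIV_pos_inc_right[of "\<lambda>t. g t - t" "g' z - 1" z] z by auto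
  have "(g \<longlongrightarrow> g z) (nhds z)"
    using cont[of z] unfolding isCont_def tendsto_at_iff_tendsto_nhds .
  then have "eventually (\<lambda>t. g t < e) (nhds z)" using z by (intro order_tendstoD) simp_all
  then obtain h' where h': "h' > 0" "\<And>t. dist t z < h' \<Longrightarrow> g t < e"
    unfolding eventually_nhds_metric by auto
  define s where "s = min h (min h' (e - z)) / 2"
  have s: "0 < s" "s < h" "s < h'" "s < e - z" using h h' z by (auto simp: s_def)
  define t where "t = z + s"
  have t: "z < t" "t < e" "t < g t" "g t < e"
    using s z h(2)[of s] h'(2)[of t] by (auto simp: t_def dist_real_def)
  define T where "T k = (g ^^ k) t" for k
  \<comment> \<open>Monotonicity of the iterate is applied to \<open>t\<close> < \<open>g t\<close>,
    both of which lie below \<open>e\<close>; the later points \<open>T k\<close> may have passed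
    \<open>e\<close>.\<close>
  have inc: "T k < T (Suc k)" for k
    using mono[of t "g t" k] t by (simp add: T_def funpow_swap1)
  have TI: "T k \<in> {c..d}" for k using bound[of t k] t by (simp add: T_def)
  have "incseq T" using inc by (intro incseq_SucI) (simp add: less_imp_le)
  then obtain w where w: "T \<longlonglongrightarrow> w" "\<And>k. T k \<le> w"
    using TI incseq_convergent[of T d] by auto
  have lt: "T k < w" for k using inc[of k] w(2)[of "Suc k"] by linarith
  have "(\<lambda>k. g (T k)) \<longlonglongrightarrow> g w" using cont w(1) by (simp add: isCont_tendsto_compose)
  moreover have "(\<lambda>k. g (T k)) \<longlonglongrightarrow> w" using LIMSEQ_Suc[OF w(1)] by (simp add: T_def)
  ultimately have gw: "g w = w" using LIMSEQ_unique by blast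
  have "((\<lambda>x. (g x - g w) / (x - w)) \<longlongrightarrow> g' w) (at w)"
    using der[of w] by (simp add: has_field_derivative_iff)
  moreover have "filterlim T (at w) sequentially"
    using w(1) lt by (auto simp: filterlim_at less_imp_neq)
  ultimately have "(\<lambda>k. (g (T k) - g w) / (T k - w)) \<longlonglongrightarrow> g' w"
    by (rule filterlim_compose)
  \<comment> \<open>The chord slope is (w - T (k+1)) / (w - T k), where T k < T (k+1) < w.\<close>
  moreover have "(g (T k) - g w) / (T k - w) \<in> {0..1}" for k
  proof -
    have "g (T k) = T (Suc k)" by (simp add: T_def)
    then show ?thesis using lt[of k] lt[of "Suc k"] inc[of k] gw by (simp add: divide_simps)
  qed
  ultimately have "g' w \<in> {0..1}" by (intro Lim_in_closed_set[of "{0..1}"]) auto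
  moreover have "w \<in> {c..d}" using w(1) TI by (intro Lim_in_closed_set[of "{c..d}" T]) auto
  ultimately show ?thesis using gw by auto
qed

text \<open>Conjugation by t -> -t reduces this to the right-hand version.\<close>

lemma nonrepelling_fixpoint_left:
  fixes g g' :: "real \<Rightarrow> real"
  assumes der: "\<And>t. (g has_real_derivative g' t) (at t)"
    and z: "e < z" "g z = z" "g' z > 1"
    and mono: "\<And>k s t. e < s \<Longrightarrow> s < t \<Longrightarrow> t \<le> z \<Longrightarrow> (g ^^ k) s < (g ^^ k) t"
    and bound: "\<And>k t. e < t \<Longrightarrow> t \<le> z \<Longrightarrow> (g ^^ k) t \<in> {c..d}"
  shows "\<exists>w\<in>{c..d}. g w = w \<and> \<bar>g' w\<bar> \<le> 1"
proof -
  define h where "h t = - g (- t)" for t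
  have hk: "(h ^^ k) t = - (g ^^ k) (- t)" for k t by (induction k) (auto simp: h_def)
  have "\<exists>w\<in>{-d..-c}. h w = w \<and> \<bar>g' (- w)\<bar> \<le> 1"
  proof (rule nonrepelling_fixpoint_right)
    show "(h has_real_derivative g' (- t)) (at t)" for t
      unfolding h_def[abs_def]
      by (rule derivative_eq_intros DERIV_chain2[OF der] refl)+ simp
    show "(h ^^ k) t \<in> {-d..-c}" if "- z \<le> t" "t < - e" for k t
      using bound[of "- t" k] that by (auto simp: hk)
    show "(h ^^ k) s < (h ^^ k) t" if "- z \<le> s" "s < t" "t < - e" for k s t
      using mono[of "- t" "- s" k] that by (auto simp: hk)
  qed (use z in \<open>auto simp: h_def\<close>)
  then obtain w where "w \<in> {-d..-c}" "h w = w" "\<bar>g' (- w)\<bar> \<le> 1" by blast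
  then show ?thesis by (intro bexI[of _ "- w"]) (auto simp: h_def)
qed

text \<open>\<open>P\<close> is any return time of \<open>z\<close>, not only the minimal one, so
  that a negative multiplier can be made positive by doubling the period.\<close>

locale preperiodic_critical_orbit =
  fixes a z :: real and N P :: nat
  assumes a_pos: "0 < a" and a_le: "a \<le> 2"
    and N: "1 \<le> N" and P: "1 \<le> P"
    and hit: "(quad a ^^ N) 0 = z"
    and per: "(quad a ^^ P) z = z"
    and repelling: "dquad a P z > 1"
begin

lemma z_in_I: "z \<in> I"
  using quad_funpow_in_I[of a 0 N] a_pos a_le hit by simp

definition postcritical :: "real set" where
  "postcritical = range (\<lambda>n. (quad a ^^ n) 0)"

lemma postcritical_funpow: "c \<in> postcritical \<Longrightarrow> (quad a ^^ n) c \<in> postcritical"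
  by (auto simp: postcritical_def quad_funpow_add[symmetric])

lemma finite_postcritical: "finite postcritical"
proof -
  have "(quad a ^^ n) 0 \<in> (\<lambda>n. (quad a ^^ n) 0) ` {..<N + P}" for n
  proof (induction n rule: less_induct)
    case (less n)
    show ?case
    proof (cases "n < N + P")
      case False
      define m where "m = n - (N + P)"
      have n: "n = m + (P + N)" using False by (simp add: m_def)
      have "(quad a ^^ n) 0 = (quad a ^^ (m + N)) 0"
        unfolding n using hit per by (simp only: quad_funpow_add)
      then show ?thesis using less.IH[of "m + N"] n P by simp
    qed simp
  qed
  then have "postcritical \<subseteq> (\<lambda>n. (quad a ^^ n) 0) ` {..<N + P}"
    by (auto simp: postcritical_def)
  then show ?thesis by (rule finite_subset) simp
qed

lemma orbit_z_nonzero: "(quad a ^^ n) z \<noteq> 0"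
proof
  assume 0: "(quad a ^^ n) z = 0"
  \<comment> \<open>The multiple of \<open>P\<close> is taken beyond \<open>n\<close>, so that the
    point at time \<open>n\<close> contributes a factor to the product.\<close>
  have "dquad a (Suc n * P) z \<noteq> 0"
    using repelling by (simp only: dquad_periodic[OF per]) simp
  moreover have "n < Suc n * P" using P by (cases P) auto
  ultimately show False using 0 by (auto simp: dquad_def)
qed

lemma dquad_z_nonzero: "dquad a n z \<noteq> 0"
  using orbit_z_nonzero a_pos by (simp add: dquad_def)

text \<open>A postcritical periodic point lies on the cycle of \<open>z\<close> and shares its
  multiplier. Otherwise the orbit of \<open>w\<close> avoids the postcritical set and every step
  expands the density strictly; after \<open>P\<close> steps the density is back at its initial
  value, so the multiplier exceeds 1 in modulus.\<close>

lemma periodic_repelling: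
  assumes w: "w \<in> I" "(quad a ^^ P) w = w"
  shows "\<bar>dquad a P w\<bar> > 1"
proof (cases "w \<in> postcritical")
  case True
  then obtain j where j: "w = (quad a ^^ j) 0" by (auto simp: postcritical_def)
  \<comment> \<open>A delay by \<open>N * P\<close>, at least \<open>N\<close>, leaves
    \<open>w\<close> unchanged and makes the critical orbit pass through \<open>z\<close>
    first.\<close>
  have "w = (quad a ^^ (N * P + j)) 0"
    using quad_funpow_periodic[OF w(2), of N] by (simp add: quad_funpow_add j)
  moreover have "N * P + j = (N * P + j - N) + N" using P by (cases P) auto
  ultimately obtain l where l: "w = (quad a ^^ l) z"
    using hit by (metis quad_funpow_add)
  \<comment> \<open>Both sides are the derivative of the iterate of order \<open>P + l\<close> at
    \<open>z\<close>.\<close>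
  have "dquad a P w * dquad a l z = dquad a l z * dquad a P z"
    using dquad_add[of a P l z] dquad_add[of a l P z] per l by (simp add: add.commute)
  then have "dquad a P w = dquad a P z" using dquad_z_nonzero[of l] by simp
  then show ?thesis using repelling by simp
next
  case False
  have notin: "(quad a ^^ n) w \<notin> postcritical" for n
  proof
    assume "(quad a ^^ n) w \<in> postcritical"
    then have "(quad a ^^ (n * P - n)) ((quad a ^^ n) w) \<in> postcritical"
      by (rule postcritical_funpow)
    moreover have "n * P = (n * P - n) + n" using P by (cases P) auto
    ultimately have "(quad a ^^ (n * P)) w \<in> postcritical" by (metis quad_funpow_add)
    then show False using False quad_funpow_periodic[OF w(2)] by simp
  qed
  have ends: "1 \<in> postcritical" "1 - a \<in> postcritical" "0 \<in> postcritical"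
    using rangeI[of "\<lambda>n. (quad a ^^ n) 0" 1] rangeI[of "\<lambda>n. (quad a ^^ n) 0" 2]
      rangeI[of "\<lambda>n. (quad a ^^ n) 0" 0]
    by (simp_all add: postcritical_def quad_def numeral_2_eq_2)
  have image: "quad a t \<in> {1 - a..1}" if "t \<in> I" for t
  proof -
    have "t\<^sup>2 \<le> 1" using that by (simp add: abs_square_le_1 abs_le_iff)
    then have "a * t\<^sup>2 \<le> a * 1" using a_pos by (intro mult_left_mono) auto
    then show ?thesis using a_pos by (simp add: quad_def)
  qed
  \<comment> \<open>Each point of the cycle is an image of a point of \<open>I\<close>, hence lies
    in [1-a, 1], and it differs from the postcritical end points. This provides the points on both
    sides that \<open>hyp_density\<close> requires.\<close>
  have between: "1 - a < (quad a ^^ n) w \<and> (quad a ^^ n) w < 1" for n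
  proof -
    have "n + P = Suc (n + (P - 1))" using P by simp
    then have "(quad a ^^ Suc (n + (P - 1))) w = (quad a ^^ n) w"
      using w(2) quad_funpow_add[of n P a w] by metis
    then have "(quad a ^^ n) w = quad a ((quad a ^^ (n + (P - 1))) w)" by simp
    moreover have "(quad a ^^ (n + (P - 1))) w \<in> I"
      using quad_funpow_in_I a_pos a_le w by simp
    ultimately have "(quad a ^^ n) w \<in> {1 - a..1}" using image by metis
    moreover have "(quad a ^^ n) w \<noteq> 1" "(quad a ^^ n) w \<noteq> 1 - a"
      using notin[of n] ends by metis+
    ultimately show ?thesis by auto
  qed
  let ?\<rho> = "hyp_density postcritical"
  have step: "?\<rho> ((quad a ^^ n) w) < ?\<rho> ((quad a ^^ Suc n) w) * \<bar>2 * a * (quad a ^^ n) w\<bar>" for n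
    using hyp_density_quad_less[of postcritical a "(quad a ^^ n) w" "1 - a" 1]
      finite_postcritical ends a_pos notin between[of n] postcritical_funpow[of _ 1] by auto
  have "?\<rho> w < ?\<rho> ((quad a ^^ Suc n) w) * \<bar>dquad a (Suc n) w\<bar>" for n
  proof (induction n)
    case 0
    then show ?case using step[of 0] by (simp add: dquad_def)
  next
    case (Suc n)
    have "?\<rho> ((quad a ^^ Suc n) w) * \<bar>dquad a (Suc n) w\<bar>
        \<le> ?\<rho> ((quad a ^^ Suc (Suc n)) w) * \<bar>2 * a * (quad a ^^ Suc n) w\<bar> * \<bar>dquad a (Suc n) w\<bar>"
      using step[of "Suc n"] by (intro mult_right_mono) (auto intro: less_imp_le)
    also have "\<dots> = ?\<rho> ((quad a ^^ Suc (Suc n)) w) * \<bar>dquad a (Suc (Suc n)) w\<bar>"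
      by (simp add: dquad_def abs_mult)
    finally show ?case using Suc.IH by linarith
  qed
  from this[of "P - 1"] have "?\<rho> w < ?\<rho> w * \<bar>dquad a P w\<bar>" using P w(2) by simp
  moreover have "0 < 1 / (w - (1 - a)) + 1 / (1 - w)" using between[of 0] by (simp add: add_pos_pos)
  then have "0 < ?\<rho> w"
    using hyp_density_ge[OF finite_postcritical ends(2,1), of w] between[of 0] by simp
  ultimately show ?thesis by simp
qed

lemma funpow_sign_change:
  assumes e: "e \<in> I" "e \<noteq> z"
  shows "\<exists>m. \<exists>u\<in>open_segment z e. \<exists>v\<in>open_segment z e. (quad a ^^ m) u < 0 \<and> 0 < (quad a ^^ m) v"
proof (rule ccontr)
  assume contra: "\<not> ?thesis"
  \<comment> \<open>By induction the earlier iterates do not vanish at \<open>t\<close>, so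
    \<open>dquad a m t\<close> is nonzero. A zero at time \<open>m\<close> would thus be simple, and
    the iterate would change sign within the segment.\<close>
  have nz: "(quad a ^^ m) t \<noteq> 0" if t: "t \<in> open_segment z e" for m t
  proof (induction m rule: less_induct)
    case (less m)
    have d: "dquad a m t \<noteq> 0" using less a_pos by (auto simp: dquad_def)
    show ?case
    proof
      assume 0: "(quad a ^^ m) t = 0"
      have "open (open_segment z e)" by (simp add: open_segment_eq_real_ivl)
      then obtain r where r: "r > 0" "\<And>s. \<bar>s - t\<bar> < r \<Longrightarrow> s \<in> open_segment z e"
        using t unfolding open_dist by (auto simp: dist_real_def)
      have "\<exists>d>0. \<forall>h>0. h < d \<longrightarrow> (quad a ^^ m) (t - h) * (quad a ^^ m) (t + h) < 0"
      proof (cases "dquad a m t > 0")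
        case True
        from DERIV_pos_inc_right[OF DERIV_quad_funpow True] DERIV_pos_inc_left[OF DERIV_quad_funpow True]
        obtain d d' where "d > 0" "\<And>h. 0 < h \<Longrightarrow> h < d \<Longrightarrow> 0 < (quad a ^^ m) (t + h)"
          "d' > 0" "\<And>h. 0 < h \<Longrightarrow> h < d' \<Longrightarrow> (quad a ^^ m) (t - h) < 0" using 0 by auto
        then show ?thesis by (intro exI[of _ "min d d'"]) (auto intro: mult_neg_pos)
      next
        case False
        then have n: "dquad a m t < 0" using d by simp
        from DERIV_neg_dec_right[OF DERIV_quad_funpow n] DERIV_neg_dec_left[OF DERIV_quad_funpow n]
        obtain d d' where "d > 0" "\<And>h. 0 < h \<Longrightarrow> h < d \<Longrightarrow> (quad a ^^ m) (t + h) < 0"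
          "d' > 0" "\<And>h. 0 < h \<Longrightarrow> h < d' \<Longrightarrow> 0 < (quad a ^^ m) (t - h)" using 0 by auto
        then show ?thesis by (intro exI[of _ "min d d'"]) (auto intro: mult_pos_neg)
      qed
      then obtain d where d: "d > 0" "\<And>h. 0 < h \<Longrightarrow> h < d \<Longrightarrow> (quad a ^^ m) (t - h) * (quad a ^^ m) (t + h) < 0"
        by auto
      define h where "h = min d r / 2"
      have h: "0 < h" "h < d" "h < r" using d r by (auto simp: h_def)
      have "t - h \<in> open_segment z e" "t + h \<in> open_segment z e" using r(2) h by auto
      then show False using d(2)[OF h(1,2)] contra by (auto simp: mult_less_0_iff)
    qed
  qed
  \<comment> \<open>The end point \<open>z\<close> is included because the sign of the derivative is
    known there: it is a power of the positive multiplier. Connectedness carries this sign to all of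
    \<open>S\<close>.\<close>
  define S where "S = insert z (open_segment z e)"
  have S: "S = (if z < e then {z..<e} else {e<..z})"
    using e by (auto simp: S_def open_segment_eq_real_ivl)
  have "connected S" by (simp add: S)
  have dnz: "dquad a n t \<noteq> 0" if "t \<in> S" for n t
    using that nz orbit_z_nonzero a_pos by (auto simp: S_def dquad_def)
  have dpos: "0 < dquad a (k * P) t" if t: "t \<in> S" for k t
  proof (rule ccontr)
    assume "\<not> ?thesis"
    moreover have "0 < dquad a (k * P) z" using repelling by (simp add: dquad_periodic[OF per])
    moreover have "z \<in> S" by (simp add: S_def)
    moreover have "connected (dquad a (k * P) ` S)"
      using \<open>connected S\<close>
      by (intro connected_continuous_image) (auto simp: continuous_on_def intro!: tendsto_intros)
    ultimately have "0 \<in> dquad a (k * P) ` S"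
      using t connectedD_interval[of "dquad a (k * P) ` S" "dquad a (k * P) t" "dquad a (k * P) z" 0] by auto
    then show False using dnz by auto
  qed
  have pow: "((quad a ^^ P) ^^ k) = (quad a ^^ (k * P))" for k
    by (simp add: funpow_mult mult.commute)
  have mono: "((quad a ^^ P) ^^ k) s < ((quad a ^^ P) ^^ k) t" if "s \<in> S" "t \<in> S" "s < t" for k s t
    unfolding pow
  proof (rule DERIV_pos_imp_increasing[OF that(3)])
    fix r assume "s \<le> r" "r \<le> t"
    then have "0 < dquad a (k * P) r" using that by (intro dpos) (auto simp: S split: if_splits)
    then show "\<exists>y. ((quad a ^^ (k * P)) has_real_derivative y) (at r) \<and> 0 < y"
      using DERIV_quad_funpow by blast
  qed
  have bound: "((quad a ^^ P) ^^ k) t \<in> I" if "t \<in> S" for k t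
  proof -
    have "t \<in> I" using that e z_in_I by (auto simp: S split: if_splits)
    then show ?thesis unfolding pow using quad_funpow_in_I a_pos a_le by simp
  qed
  have "\<exists>w\<in>I. (quad a ^^ P) w = w \<and> \<bar>dquad a P w\<bar> \<le> 1"
  proof (cases "z < e")
    case True
    show ?thesis
      by (rule nonrepelling_fixpoint_right[OF DERIV_quad_funpow True per repelling])
        (use True in \<open>auto intro!: mono bound simp: S simp del: atLeastAtMost_iff\<close>)
  next
    case False
    then have "e < z" using e by simp
    show ?thesis
      by (rule nonrepelling_fixpoint_left[OF DERIV_quad_funpow \<open>e < z\<close> per repelling])
        (use False in \<open>auto intro!: mono bound simp: S simp del: atLeastAtMost_iff\<close>)
  qed
  then show False using periodic_repelling by (meson not_less)
qed

end

subsection \<open>Returns of the critical orbit for nearby parameters\<close>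

lemma finite_critical_relation:
  assumes "1 \<le> m" "m < n"
  shows "finite {b :: real. (quad b ^^ m) 0 = (quad b ^^ n) 0}"
proof -
  have "\<exists>q. \<forall>b :: real. (quad b ^^ n) 0 = poly q b" for n
  proof (induction n)
    case 0
    then show ?case by (intro exI[of _ 0]) simp
  next
    case (Suc n)
    then obtain q where q: "\<And>b :: real. (quad b ^^ n) 0 = poly q b" by blast
    have "(quad b ^^ Suc n) 0 = quad b (poly q b)" for b by (simp add: q)
    also have "quad b (poly q b) = poly (1 - [:0, 1:] * q ^ 2) b" for b by (simp add: quad_def)
    finally show ?case by blast
  qed
  then obtain q where q: "\<And>n b. (quad b ^^ n) 0 = poly (q n) b" by metis
  \<comment> \<open>For \<open>b = 3\<close> the critical orbit decreases strictly from time \<open>1\<close> on, so the two polynomials differ.\<close>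
  have low: "(quad 3 ^^ (k + 2)) 0 \<le> -1" for k
  proof (induction k)
    case 0
    then show ?case by (simp add: quad_def numeral_2_eq_2)
  next
    case (Suc k)
    define t where "t = (quad 3 ^^ (k + 2)) 0"
    have "1\<^sup>2 \<le> (- t)\<^sup>2" using Suc unfolding t_def by (intro power_mono) auto
    then have "quad 3 t \<le> -1" by (simp add: quad_def)
    then show ?case by (simp add: t_def)
  qed
  \<comment> \<open>Either case gives t^2 + t >= 0 and t^2 >= 1, so 3 t^2 + t >= 2 > 1.\<close>
  have dec: "quad 3 t < t" if "t \<le> -1 \<or> t = 1" for t
  proof -
    have "0 \<le> t * (t + 1)" "0 \<le> (t + 1) * (t - 1)" using that by (auto intro: mult_nonpos_nonpos)
    then have "0 \<le> t\<^sup>2 + t" "1 \<le> t\<^sup>2" by (simp_all add: algebra_simps power2_eq_square)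
    then show ?thesis by (simp add: quad_def)
  qed
  have "(quad 3 ^^ Suc (k + 1)) 0 < (quad 3 ^^ (k + 1)) 0" for k
  proof -
    have "(quad 3 ^^ (k + 1)) 0 \<le> -1 \<or> (quad 3 ^^ (k + 1)) 0 = 1"
      using low[of "k - 1"] by (cases k) (auto simp: quad_def)
    from dec[OF this] show ?thesis by simp
  qed
  then have step: "(quad 3 ^^ Suc k) 0 < (quad 3 ^^ k) 0" if "1 \<le> k" for k
    using that by (metis add.commute le_Suc_ex plus_1_eq_Suc)
  have "(quad 3 ^^ (m + Suc k)) 0 < (quad 3 ^^ m) 0" for k
  proof (induction k)
    case 0
    then show ?case using step[of m] assms(1) by simp
  next
    case (Suc k)
    then show ?case using step[of "m + Suc k"] by simp
  qed
  from this[of "n - Suc m"] have "(quad 3 ^^ n) 0 < (quad 3 ^^ m) 0" using assms(2) by simp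
  then have "poly (q m - q n) 3 \<noteq> 0" by (simp add: q)
  then have "q m - q n \<noteq> 0" by auto
  then have "finite {b. poly (q m - q n) b = 0}" by (rule poly_roots_finite)
  then show ?thesis by (simp add: q)
qed

section \<open>Escape from the cycle and return to the critical point\<close>

context preperiodic_critical_orbit
begin

text \<open>Joint continuity keeps the derivative above \<open>\<sigma>\<close>, the midpoint of 1
  and the multiplier, near \<open>(a, z)\<close>; the mean value theorem does the rest. The radius
  \<open>\<delta>\<close> is the same for all \<open>b\<close> near \<open>a\<close>.\<close>

lemma expansion:
  "\<exists>\<sigma>>1. \<exists>\<delta>>0. \<forall>\<^sub>F b in nhds a. \<forall>s t. \<bar>s - z\<bar> \<le> \<delta> \<longrightarrow> \<bar>t - z\<bar> \<le> \<delta> \<longrightarrow>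
     \<sigma> * \<bar>s - t\<bar> \<le> \<bar>(quad b ^^ P) s - (quad b ^^ P) t\<bar>"
proof -
  define \<sigma> where "\<sigma> = (1 + dquad a P z) / 2"
  have \<sigma>: "1 < \<sigma>" "\<sigma> < dquad a P z" using repelling by (auto simp: \<sigma>_def)
  have "((\<lambda>y. dquad (fst y) P (snd y)) \<longlongrightarrow> dquad (fst (a, z)) P (snd (a, z))) (nhds (a, z))"
    by (intro tendsto_dquad tendsto_fst tendsto_snd filterlim_ident)
  then have "\<forall>\<^sub>F y in nhds a \<times>\<^sub>F nhds z. \<sigma> < dquad (fst y) P (snd y)"
    using \<sigma> by (intro order_tendstoD) (auto simp: nhds_prod)
  then obtain Pa Pz where ev: "eventually Pa (nhds a)" "eventually Pz (nhds z)"
    and imp: "\<And>b t. Pa b \<Longrightarrow> Pz t \<Longrightarrow> \<sigma> < dquad b P t"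
    by (auto simp: eventually_prod_filter)
  obtain d where d: "d > 0" "\<And>t. dist t z < d \<Longrightarrow> Pz t"
    using ev(2) by (auto simp: eventually_nhds_metric)
  have exp: "\<sigma> * \<bar>s - t\<bar> \<le> \<bar>(quad b ^^ P) s - (quad b ^^ P) t\<bar>"
    if b: "Pa b" and st: "\<bar>s - z\<bar> \<le> d / 2" "\<bar>t - z\<bar> \<le> d / 2" "s < t" for b s t
  proof -
    obtain r where r: "s < r" "r < t"
      "(quad b ^^ P) t - (quad b ^^ P) s = (t - s) * dquad b P r"
      using MVT2[OF st(3), of "quad b ^^ P" "dquad b P"] DERIV_quad_funpow by auto
    have "\<bar>r - z\<bar> < d" using r(1,2) st d(1) by linarith
    then have "\<sigma> < dquad b P r" using b by (intro imp d) (simp_all add: dist_real_def)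
    then have "\<sigma> * (t - s) \<le> (t - s) * dquad b P r"
      using st by (subst mult.commute) (intro mult_left_mono, auto)
    also have "\<dots> = (quad b ^^ P) t - (quad b ^^ P) s" using r(3) by simp
    also have "\<dots> \<le> \<bar>(quad b ^^ P) s - (quad b ^^ P) t\<bar>" by simp
    also have "t - s = \<bar>s - t\<bar>" using st(3) by simp
    finally show ?thesis .
  qed
  have exp': "\<sigma> * \<bar>s - t\<bar> \<le> \<bar>(quad b ^^ P) s - (quad b ^^ P) t\<bar>"
    if "Pa b" "\<bar>s - z\<bar> \<le> d / 2" "\<bar>t - z\<bar> \<le> d / 2" for b s t
    using exp[OF that] exp[OF that(1,3,2)] by (cases s t rule: linorder_cases) (auto simp: abs_minus_commute)
  then show ?thesis using d \<sigma> ev(1)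
    by (intro exI[of _ \<sigma>] conjI exI[of _ "d / 2"]) (auto elim: eventually_mono)
qed

text \<open>As \<open>z\<close> need not be fixed for \<open>b\<close>, gaps between successive
  returns are tracked instead of distances to \<open>z\<close>. They grow geometrically from a
  nonzero start, yet would be bounded by 2 \<open>\<delta>\<close> if no return escaped.\<close>

lemma escape:
  assumes exp: "\<And>s t. \<bar>s - z\<bar> \<le> \<delta> \<Longrightarrow> \<bar>t - z\<bar> \<le> \<delta> \<Longrightarrow>
      \<sigma> * \<bar>s - t\<bar> \<le> \<bar>(quad b ^^ P) s - (quad b ^^ P) t\<bar>"
    and "1 < \<sigma>" and neq: "(quad b ^^ N) 0 \<noteq> (quad b ^^ (N + P)) 0"
  shows "\<exists>j. \<delta> \<le> \<bar>(quad b ^^ (N + j * P)) 0 - z\<bar>"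
proof (rule ccontr)
  assume "\<not> ?thesis"
  then have near: "\<bar>(quad b ^^ (N + j * P)) 0 - z\<bar> < \<delta>" for j by (auto simp: not_le)
  define c where "c j = (quad b ^^ (N + j * P)) 0" for j
  have cS: "c (Suc j) = (quad b ^^ P) (c j)" for j
    using quad_funpow_add[of P "N + j * P" b 0] by (simp add: c_def add_ac)
  have grow: "\<sigma> ^ j * \<bar>c 0 - c 1\<bar> \<le> \<bar>c j - c (Suc j)\<bar>" for j
  proof (induction j)
    case (Suc j)
    have "\<sigma> ^ Suc j * \<bar>c 0 - c 1\<bar> \<le> \<sigma> * \<bar>c j - c (Suc j)\<bar>"
      using Suc \<open>1 < \<sigma>\<close> by (simp add: mult.assoc)
    also have "\<dots> \<le> \<bar>c (Suc j) - c (Suc (Suc j))\<bar>"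
      unfolding cS[of j] cS[of "Suc j"] using near[of j] near[of "Suc j"] cS[of j]
      by (intro exp) (auto simp: c_def intro: less_imp_le)
    finally show ?case .
  qed simp
  have pos: "0 < \<bar>c 0 - c 1\<bar>" using neq by (simp add: c_def)
  obtain j where "2 * \<delta> / \<bar>c 0 - c 1\<bar> < \<sigma> ^ j" using real_arch_pow[OF \<open>1 < \<sigma>\<close>] by blast
  then have "2 * \<delta> < \<sigma> ^ j * \<bar>c 0 - c 1\<bar>" using pos by (simp add: pos_divide_less_eq)
  also have "\<dots> \<le> \<bar>c j - c (Suc j)\<bar>" by (rule grow)
  also have "\<dots> \<le> 2 * \<delta>" using near[of j] near[of "Suc j"] by (simp add: c_def)
  finally show False by simp
qed

text \<open>The \<open>k\<close> returns close to \<open>z\<close> give long blocks that shadow the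
  cycle; the bound on \<open>N + r\<close> makes the remaining times negligible in orbit
  averages.\<close>

lemma critical_return:
  assumes \<epsilon>: "\<epsilon> > 0"
  shows "\<exists>b k r. 0 < b \<and> b \<le> 2 \<and> \<bar>b - a\<bar> < \<epsilon> \<and> 1 \<le> k \<and> (quad b ^^ (N + k * P + r)) 0 = 0 \<and>
    real (N + r) \<le> \<epsilon> * real k \<and> (\<forall>j<k. \<bar>(quad b ^^ (N + j * P)) 0 - z\<bar> < \<epsilon>)"
proof -
  obtain \<sigma> \<delta>0 where \<sigma>: "1 < \<sigma>" and \<delta>0: "0 < \<delta>0"
    and exp: "\<forall>\<^sub>F b in nhds a. \<forall>s t. \<bar>s - z\<bar> \<le> \<delta>0 \<longrightarrow> \<bar>t - z\<bar> \<le> \<delta>0 \<longrightarrow>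
      \<sigma> * \<bar>s - t\<bar> \<le> \<bar>(quad b ^^ P) s - (quad b ^^ P) t\<bar>"
    using expansion by blast
  define \<delta> where "\<delta> = min \<delta>0 (\<epsilon> / 2)"
  have \<delta>: "0 < \<delta>" "\<delta> \<le> \<delta>0" "\<delta> < \<epsilon>" using \<delta>0 \<epsilon> by (auto simp: \<delta>_def)
  define \<xi> where "\<xi> i b = (quad b ^^ (N + i * P)) 0" for i b
  have \<xi>a: "\<xi> i a = z" for i
    by (simp add: \<xi>_def add.commute[of N] quad_funpow_add hit quad_funpow_periodic[OF per])
  have cont: "continuous_on S (\<xi> i)" for i S
    unfolding \<xi>_def[abs_def] by (intro continuous_intros)
  have "\<exists>m. e \<in> I \<longrightarrow> e \<noteq> z \<longrightarrow> (\<exists>u\<in>open_segment z e. \<exists>v\<in>open_segment z e.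
      (quad a ^^ m) u < 0 \<and> 0 < (quad a ^^ m) v)" for e
    using funpow_sign_change by blast
  then obtain m where "\<And>e. e \<in> I \<Longrightarrow> e \<noteq> z \<Longrightarrow> \<exists>u\<in>open_segment z e. \<exists>v\<in>open_segment z e.
      (quad a ^^ m e) u < 0 \<and> 0 < (quad a ^^ m e) v"
    by metis
  then obtain u v where uv: "\<And>e. e \<in> I \<Longrightarrow> e \<noteq> z \<Longrightarrow> u e \<in> open_segment z e \<and> v e \<in> open_segment z e \<and>
      (quad a ^^ m e) (u e) < 0 \<and> 0 < (quad a ^^ m e) (v e)"
    by metis
  have sign: "\<forall>\<^sub>F b in nhds a. e \<in> I \<longrightarrow> (quad b ^^ m e) (u e) < 0 \<and> 0 < (quad b ^^ m e) (v e)"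
    if "e \<noteq> z" for e
  proof (cases "e \<in> I")
    case True
    have lim: "((\<lambda>b. (quad b ^^ m e) t) \<longlongrightarrow> (quad a ^^ m e) t) (nhds a)" for t
      by (intro tendsto_quad_funpow filterlim_ident tendsto_const)
    have "\<forall>\<^sub>F b in nhds a. (quad b ^^ m e) (u e) < 0" "\<forall>\<^sub>F b in nhds a. 0 < (quad b ^^ m e) (v e)"
      using uv[OF True that] by (auto intro!: order_tendstoD[OF lim])
    then show ?thesis by eventually_elim simp
  qed auto
  \<comment> \<open>Only \<open>z - \<delta>\<close> and \<open>z + \<delta>\<close> will occur as
    \<open>e\<close>, so \<open>R\<close> bounds the final time \<open>m e\<close>. Thus
    \<open>K\<close> can be fixed before the neighbourhood of \<open>a\<close>, which is then chosen
    so small that no escape occurs up to time \<open>K\<close>.\<close>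
  define R where "R = m (z - \<delta>) + m (z + \<delta>)"
  obtain K :: nat where K: "real (N + R) / \<epsilon> < real K" using reals_Archimedean2 by blast
  have "\<forall>\<^sub>F b in nhds a. \<bar>\<xi> i b - z\<bar> < \<delta>" for i
  proof -
    have "((\<lambda>b. \<bar>\<xi> i b - z\<bar>) \<longlongrightarrow> \<bar>\<xi> i a - z\<bar>) (nhds a)"
      unfolding \<xi>_def by (intro tendsto_intros filterlim_ident)
    then show ?thesis using \<delta> by (intro order_tendstoD(2)) (auto simp: \<xi>a)
  qed
  then have close: "\<forall>\<^sub>F b in nhds a. \<forall>i\<in>{..K}. \<bar>\<xi> i b - z\<bar> < \<delta>"
    by (intro eventually_ball_finite) auto
  let ?Z = "{b. (quad b ^^ N) 0 = (quad b ^^ (N + P)) 0}"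
  have "finite ?Z" using N P by (intro finite_critical_relation) auto
  then have "open (- (?Z - {a}))" by (intro open_Compl finite_imp_closed) simp
  then have neq: "\<forall>\<^sub>F b in nhds a. b \<in> - (?Z - {a})" by (intro eventually_nhds_in_open) auto
  have "z - \<delta> \<noteq> z" "z + \<delta> \<noteq> z" using \<delta> by auto
  from eventually_conj[OF exp eventually_conj[OF sign[OF this(1)] eventually_conj[OF sign[OF this(2)]
        eventually_conj[OF close neq]]]]
  obtain d where d: "0 < d" and near: "\<And>b s t. \<bar>b - a\<bar> < d \<Longrightarrow> \<bar>s - z\<bar> \<le> \<delta>0 \<Longrightarrow> \<bar>t - z\<bar> \<le> \<delta>0 \<Longrightarrow>
      \<sigma> * \<bar>s - t\<bar> \<le> \<bar>(quad b ^^ P) s - (quad b ^^ P) t\<bar>"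
    "\<And>b e. \<bar>b - a\<bar> < d \<Longrightarrow> e \<in> {z - \<delta>, z + \<delta>} \<Longrightarrow> e \<in> I \<Longrightarrow>
      (quad b ^^ m e) (u e) < 0 \<and> 0 < (quad b ^^ m e) (v e)"
    "\<And>b i. \<bar>b - a\<bar> < d \<Longrightarrow> i \<le> K \<Longrightarrow> \<bar>\<xi> i b - z\<bar> < \<delta>"
    "\<And>b. \<bar>b - a\<bar> < d \<Longrightarrow> b \<noteq> a \<Longrightarrow> (quad b ^^ N) 0 \<noteq> (quad b ^^ (N + P)) 0"
    unfolding eventually_nhds_metric dist_real_def by (elim exE conjE) fast
  \<comment> \<open>Parameters to the left of \<open>a\<close> stay at most 2 even if
    \<open>a\<close> = 2; the bound by \<open>a / 2\<close> keeps them positive.\<close>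
  define b0 where "b0 = a - min d (min \<epsilon> a) / 2"
  have b0: "b0 < a" "0 < b0" "a - b0 < d" "a - b0 < \<epsilon>"
    using d \<epsilon> a_pos by (auto simp: b0_def min_def)
  have param: "\<bar>b - a\<bar> < d" "\<bar>b - a\<bar> < \<epsilon>" "0 < b" "b \<le> 2" if "b \<in> {b0..a}" for b
    using that b0 a_le by auto
  have \<xi>I: "\<xi> i b \<in> I" if "b \<in> {b0..a}" for i b
    unfolding \<xi>_def using param[OF that] by (intro quad_funpow_in_I) auto
  have "\<exists>j. \<delta> \<le> \<bar>(quad b0 ^^ (N + j * P)) 0 - z\<bar>"
    using param[of b0] b0 \<delta> near by (intro escape[of \<delta> \<sigma>] \<sigma>) auto
  then obtain k0 where k0: "\<delta> \<le> \<bar>\<xi> k0 b0 - z\<bar>" by (auto simp: \<xi>_def)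
  \<comment> \<open>Capping the time at \<open>k0\<close> makes this a finite union of closed sets,
    so a last parameter exists.\<close>
  define D where "D = (\<Union>i\<in>{..k0}. {b \<in> {b0..a}. \<delta> \<le> \<bar>\<xi> i b - z\<bar>})"
  have "closed D"
    unfolding D_def by (intro closed_UN finite_atMost ballI continuous_on_closed_Collect_le continuous_intros cont)
  moreover have "bounded D" by (rule bounded_subset[of "{b0..a}"]) (auto simp: D_def)
  ultimately have "compact D" by (simp add: compact_eq_bounded_closed)
  moreover have "b0 \<in> D" using k0 b0 by (auto simp: D_def)
  ultimately obtain b1 where b1: "b1 \<in> D" "\<And>b. b \<in> D \<Longrightarrow> b \<le> b1"
    using compact_attains_sup[of D] by auto
  then obtain k where k: "k \<le> k0" "b1 \<in> {b0..a}" "\<delta> \<le> \<bar>\<xi> k b1 - z\<bar>" by (auto simp: D_def)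
  \<comment> \<open>As \<open>b1\<close> is the last parameter with an escape before time \<open>k0\<close>, on all of \<open>[b1, a]\<close> the points
    \<open>\<xi> i b\<close> with \<open>i \<le> k0\<close> remain close to \<open>z\<close>, while \<open>\<xi> k b\<close> moves from \<open>z \<plusminus> \<delta>\<close> to \<open>z\<close>.\<close>
  have "b1 < a" using k \<xi>a[of k] \<delta> by (cases "b1 = a") auto
  have stay: "\<bar>\<xi> i b - z\<bar> < \<delta>" if "b1 < b" "b \<le> a" "i \<le> k0" for i b
    using b1(2)[of b] that k by (force simp: D_def)
  \<comment> \<open>A one-sided limit includes \<open>b1\<close>; with the escape at time
    \<open>k\<close> this puts \<open>\<xi> k b1\<close> at distance exactly \<open>\<delta>\<close>
    from \<open>z\<close>.\<close>
  have stay': "\<bar>\<xi> i b - z\<bar> \<le> \<delta>" if "b \<in> {b1..a}" "i \<le> k0" for i b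
  proof (cases "b = b1")
    case True
    have "((\<lambda>b. \<bar>\<xi> i b - z\<bar>) \<longlongrightarrow> \<bar>\<xi> i b1 - z\<bar>) (at_right b1)"
      unfolding \<xi>_def by (intro tendsto_intros)
    moreover have "\<forall>\<^sub>F b in at_right b1. \<bar>\<xi> i b - z\<bar> \<le> \<delta>"
      unfolding eventually_at_right_field using \<open>b1 < a\<close> stay[OF _ _ that(2)]
      by (intro exI[of _ a]) (auto intro: less_imp_le)
    ultimately show ?thesis unfolding True by (rule tendsto_upperbound) simp
  next
    case False
    then show ?thesis using stay[of b i] that by auto
  qed
  define e where "e = \<xi> k b1"
  have "\<bar>e - z\<bar> = \<delta>" using stay'[of b1 k] k \<open>b1 < a\<close> by (simp add: e_def)
  then have e: "e \<in> {z - \<delta>, z + \<delta>}" "e \<noteq> z" "e \<in> I"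
    using \<delta> \<xi>I[OF k(2)] unfolding e_def by auto
  have "K < k" using near(3)[of b1 k] param[OF k(2)] k by (cases "K < k") auto
  have "connected (\<xi> k ` {b1..a})" by (intro connected_continuous_image cont) simp
  moreover have "e \<in> \<xi> k ` {b1..a}" "z \<in> \<xi> k ` {b1..a}"
    using \<open>b1 < a\<close> \<xi>a[of k] by (auto simp: e_def intro!: image_eqI[of z "\<xi> k" a])
  ultimately have "open_segment z e \<subseteq> \<xi> k ` {b1..a}"
    unfolding connected_convex_1 convex_contains_open_segment by blast
  then have "u e \<in> \<xi> k ` {b1..a}" "v e \<in> \<xi> k ` {b1..a}" using uv[OF e(3,2)] by blast+
  then obtain bu bv where bu: "bu \<in> {b1..a}" "\<xi> k bu = u e" and bv: "bv \<in> {b1..a}" "\<xi> k bv = v e"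
    by (elim imageE) simp
  \<comment> \<open>Parameter and starting point vary together. The signs at \<open>u e\<close> and
    \<open>v e\<close> hold for every parameter near \<open>a\<close>, in particular for
    \<open>bu\<close> and \<open>bv\<close>.\<close>
  let ?F = "\<lambda>b. (quad b ^^ m e) (\<xi> k b)"
  have "connected (?F ` {b1..a})" by (intro connected_continuous_image continuous_intros cont) simp
  moreover have "?F bu < 0" "0 < ?F bv"
    using near(2)[OF param(1) e(1,3)] bu bv k(2) by auto
  moreover have "?F bu \<in> ?F ` {b1..a}" "?F bv \<in> ?F ` {b1..a}"
    by (rule imageI[of _ _ ?F, OF bu(1)], rule imageI[of _ _ ?F, OF bv(1)])
  ultimately have "0 \<in> ?F ` {b1..a}"
    using connectedD_interval[of "?F ` {b1..a}" "?F bu" "?F bv" 0] by (simp only: less_imp_le)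
  then obtain b where b: "b \<in> {b1..a}" "?F b = 0" by auto
  have "m e \<le> R" using e by (auto simp: R_def)
  have "(quad b ^^ (N + k * P + m e)) 0 = 0"
    using b(2) quad_funpow_add[of "m e" "N + k * P" b 0] by (simp add: \<xi>_def add.commute)
  moreover have "real (N + m e) \<le> \<epsilon> * real k"
  proof -
    have "real (N + m e) \<le> real (N + R)" using \<open>m e \<le> R\<close> by simp
    also have "\<dots> \<le> \<epsilon> * real K" using K \<epsilon> by (simp add: pos_divide_less_eq mult.commute)
    also have "\<dots> \<le> \<epsilon> * real k" using \<open>K < k\<close> \<epsilon> by simp
    finally show ?thesis .
  qed
  moreover have "\<bar>(quad b ^^ (N + j * P)) 0 - z\<bar> < \<epsilon>" if "j < k" for j
    using stay'[OF b(1), of j] that k \<delta> by (simp add: \<xi>_def)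
  moreover have "b \<in> {b0..a}" using b k by auto
  ultimately show ?thesis using param \<open>K < k\<close>
    by (intro exI[of _ b] exI[of _ k] exI[of _ "m e"]) auto
qed

end

subsection \<open>Natural measures\<close>

lemma sum_lessThan_add:
  fixes f :: "nat \<Rightarrow> 'a::comm_monoid_add"
  shows "(\<Sum>i<m + n. f i) = (\<Sum>i<m. f i) + (\<Sum>i<n. f (m + i))"
  by (induction n) (auto simp: add.assoc)

lemma sum_lessThan_mult:
  fixes f :: "nat \<Rightarrow> 'a::comm_monoid_add"
  shows "(\<Sum>i<k * n. f i) = (\<Sum>j<k. \<Sum>i<n. f (j * n + i))"
  by (induction k) (simp_all add: sum_lessThan_add add.commute[of n])

text \<open>The minimal return time \<open>q\<close> divides \<open>M\<close>, so averages over
  \<open>M\<close> steps are averages over the cycle. Listed from index 1, the cycle ends in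
  0.\<close>

lemma superstable_of_return:
  assumes b: "0 \<le> b" "b \<le> 2" and M: "1 \<le> M" "(quad b ^^ M) 0 = 0"
  shows "\<exists>q y. superstable_attractor b q y \<and>
    (\<forall>\<phi>::real \<Rightarrow> real. (\<Sum>i=1..q. \<phi> (y i)) / q = (\<Sum>i<M. \<phi> ((quad b ^^ i) 0)) / M)"
proof -
  define q where "q = (LEAST q. 1 \<le> q \<and> (quad b ^^ q) 0 = 0)"
  have q: "1 \<le> q" "(quad b ^^ q) 0 = 0"
    using LeastI[of "\<lambda>q. 1 \<le> q \<and> (quad b ^^ q) 0 = 0" M] M by (auto simp: q_def)
  have least: "(quad b ^^ j) 0 \<noteq> 0" if "1 \<le> j" "j < q" for j
    using not_less_Least[of j "\<lambda>q. 1 \<le> q \<and> (quad b ^^ q) 0 = 0"] that by (auto simp: q_def)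
  define y where "y i = (quad b ^^ i) 0" for i
  \<comment> \<open>A coincidence, moved forward by \<open>q - j\<close> steps, would give a return
    to 0 before time \<open>q\<close>.\<close>
  have neq: "y i \<noteq> y j" if "1 \<le> i" "i < j" "j \<le> q" for i j
  proof
    assume "y i = y j"
    then have "(quad b ^^ (q - j + i)) 0 = (quad b ^^ (q - j + j)) 0"
      unfolding quad_funpow_add by (simp add: y_def)
    then have "(quad b ^^ (q - j + i)) 0 = 0" using that q by simp
    moreover have "1 \<le> q - j + i" "q - j + i < q" using that by linarith+
    ultimately show False using least by blast
  qed
  have "inj_on y {1..q}"
    by (rule linorder_inj_onI) (use neq in auto)
  moreover have "y i \<in> I" for i unfolding y_def by (rule quad_funpow_in_I) (use b in auto)
  moreover have "quad b (y q) = y 1" using q by (simp add: y_def)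
  ultimately have "periodic_orbit b q y" using q unfolding periodic_orbit_def by (auto simp: y_def)
  moreover have "0 \<in> y ` {1..q}" using q by (intro image_eqI[of _ _ q]) (auto simp: y_def)
  moreover have "(\<Sum>i=1..q. \<phi> (y i)) / q = (\<Sum>i<M. \<phi> ((quad b ^^ i) 0)) / M" for \<phi> :: "real \<Rightarrow> real"
  proof -
    have per: "(quad b ^^ (i + k * q)) 0 = (quad b ^^ i) 0" for i k
      using quad_funpow_periodic[OF q(2)] by (simp add: quad_funpow_add)
    have "(quad b ^^ (M mod q)) 0 = 0" using per[of "M mod q" "M div q"] M by simp
    then have "M mod q = 0" using least[of "M mod q"] q by (cases "M mod q = 0") auto
    then obtain k where k: "M = k * q" by (metis mod_0_imp_dvd dvd_div_mult_self)
    have "(\<Sum>i=1..q. \<phi> (y i)) = (\<Sum>i<q. \<phi> (y (Suc i)))"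
      by (simp add: sum.atLeast1_atMost_eq)
    also have "\<dots> = (\<Sum>i<Suc q. \<phi> (y i)) - \<phi> (y 0)" by (simp only: sum.lessThan_Suc_shift add_diff_cancel_left')
    also have "\<dots> = (\<Sum>i<q. \<phi> (y i))" using q by (simp add: y_def)
    finally have eq: "(\<Sum>i=1..q. \<phi> (y i)) = (\<Sum>i<q. \<phi> (y i))" .
    have "(\<Sum>i<M. \<phi> ((quad b ^^ i) 0)) = (\<Sum>j<k. \<Sum>i<q. \<phi> ((quad b ^^ (i + j * q)) 0))"
      unfolding k sum_lessThan_mult by (simp add: add.commute)
    also have "\<dots> = k * (\<Sum>i<q. \<phi> (y i))" by (simp add: per y_def)
    finally show ?thesis using eq k M q by simp
  qed
  ultimately show ?thesis unfolding superstable_attractor_def by blast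
qed

text \<open>The averaged point masses are the image under \<open>x\<close> of the uniform measure on
  the indices.\<close>

lemma integral_orbit_measure:
  assumes p: "1 \<le> p" and x: "\<And>i. i \<in> {1..p} \<Longrightarrow> x i \<in> I" and \<phi>: "continuous_on I \<phi>"
  shows "integral\<^sup>L (orbit_measure p x) \<phi> = (\<Sum>i=1..p. \<phi> (x i) :: real) / p"
proof -
  let ?U = "uniform_count_measure {1..p}"
  have meas: "x \<in> measurable ?U borel_I"
    using x by (auto simp: measurable_def space_restrict_space space_uniform_count_measure
        sets_uniform_count_measure)
  have "orbit_measure p x = distr ?U borel_I x"
  proof (rule measure_eqI)
    fix A assume "A \<in> sets (orbit_measure p x)"
    then have A: "A \<in> sets borel_I" by simp
    have "(\<Sum>i=1..p. emeasure (return borel_I (x i)) A) = (\<Sum>i=1..p. of_bool (x i \<in> A))"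
      using A by (intro sum.cong) (auto simp: indicator_def)
    also have "\<dots> = of_nat (card {i \<in> {1..p}. x i \<in> A})"
      by (simp add: sum_of_bool_eq Int_def)
    also have "{i \<in> {1..p}. x i \<in> A} = x -` A \<inter> space ?U"
      by (auto simp: space_uniform_count_measure)
    finally have "emeasure (orbit_measure p x) A = of_nat (card (x -` A \<inter> space ?U)) / of_nat p"
      using emeasure_orbit_measure[OF A] by simp
    also have "\<dots> = emeasure ?U (x -` A \<inter> space ?U)"
      using p by (subst emeasure_uniform_count_measure)
        (auto simp: space_uniform_count_measure ennreal_of_nat_eq_real_of_nat divide_ennreal)
    finally show "emeasure (orbit_measure p x) A = emeasure (distr ?U borel_I x) A"
      using emeasure_distr[OF meas A] by simp
  qed simp
  moreover have "\<phi> \<in> borel_measurable borel_I" using \<phi> by (rule borel_measurable_continuous_on_restrict)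
  ultimately have "integral\<^sup>L (orbit_measure p x) \<phi> = integral\<^sup>L ?U (\<lambda>i. \<phi> (x i))"
    using integral_distr[OF meas] by simp
  also have "\<dots> = (\<Sum>i=1..p. \<phi> (x i)) / p"
    using integral_uniform_count_measure[of "{1..p}" "\<lambda>i. \<phi> (x i)"] by simp
  finally show ?thesis .
qed

text \<open>Deviations from the block average are summed: at most 2 \<open>C\<close> for each of the
  \<open>N + r\<close> exceptional times, and at most \<open>P * \<eta>\<close> for each block,
  since the \<open>c i\<close> cancel against their average.\<close>

lemma average_near_block_average:
  fixes h c :: "nat \<Rightarrow> real"
  assumes h: "\<And>i. \<bar>h i\<bar> \<le> C" and c: "\<And>i. \<bar>c i\<bar> \<le> C"
    and close: "\<And>j i. j < k \<Longrightarrow> i < P \<Longrightarrow> \<bar>h (N + j * P + i) - c i\<bar> \<le> \<eta>"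
    and P: "1 \<le> P" and k: "1 \<le> k" and \<epsilon>: "real (N + r) \<le> \<epsilon> * real k" and "0 \<le> \<eta>"
  shows "\<bar>(\<Sum>i<N + k * P + r. h i) / (N + k * P + r) - (\<Sum>i<P. c i) / P\<bar> \<le> 2 * C * \<epsilon> + \<eta>"
proof -
  define M where "M = N + k * P + r"
  define T where "T = (\<Sum>i<P. c i) / P"
  have sumc: "(\<Sum>i<P. c i) = P * T" using P by (simp add: T_def)
  have "\<bar>\<Sum>i<P. c i\<bar> \<le> P * C" using sum_norm_bound[of "{..<P}" c C] c by simp
  then have T: "\<bar>T\<bar> \<le> C" using P by (simp add: T_def divide_le_eq mult.commute)
  have C: "0 \<le> C" using h[of 0] by linarith
  have dev: "\<bar>h i - T\<bar> \<le> 2 * C" for i using h[of i] T by linarith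
  have "(\<Sum>i<M. h i - T) = (\<Sum>i<N. h i - T) + (\<Sum>j<k. \<Sum>i<P. h (N + j * P + i) - T) + (\<Sum>i<r. h (N + k * P + i) - T)"
    unfolding M_def sum_lessThan_add sum_lessThan_mult by (simp add: add.assoc)
  moreover have "\<bar>\<Sum>i<N. h i - T\<bar> \<le> N * (2 * C)"
    using sum_norm_bound[of "{..<N}" "\<lambda>i. h i - T" "2 * C"] dev by simp
  moreover have "\<bar>\<Sum>i<r. h (N + k * P + i) - T\<bar> \<le> r * (2 * C)"
    using sum_norm_bound[of "{..<r}" "\<lambda>i. h (N + k * P + i) - T" "2 * C"] dev by simp
  moreover have "\<bar>\<Sum>j<k. \<Sum>i<P. h (N + j * P + i) - T\<bar> \<le> k * (P * \<eta>)"
  proof -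
    have "\<bar>\<Sum>i<P. h (N + j * P + i) - T\<bar> \<le> P * \<eta>" if "j < k" for j
    proof -
      have "(\<Sum>i<P. h (N + j * P + i) - T) = (\<Sum>i<P. h (N + j * P + i) - c i)"
        by (simp add: sum_subtractf sumc)
      then show ?thesis
        using sum_norm_bound[of "{..<P}" "\<lambda>i. h (N + j * P + i) - c i" \<eta>] close[OF that] by simp
    qed
    then show ?thesis
      using sum_norm_bound[of "{..<k}" "\<lambda>j. \<Sum>i<P. h (N + j * P + i) - T" "P * \<eta>"] by simp
  qed
  ultimately have "\<bar>\<Sum>i<M. h i - T\<bar> \<le> real (N + r) * (2 * C) + real (k * P) * \<eta>"
    by (simp add: algebra_simps)
  also have "\<dots> \<le> \<epsilon> * real M * (2 * C) + real M * \<eta>"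
  proof (intro add_mono mult_right_mono)
    have "0 \<le> \<epsilon> * real k" using \<epsilon> of_nat_0_le_iff[of "N + r"] by linarith
    then have "0 \<le> \<epsilon>" using k by (simp add: zero_le_mult_iff)
    moreover have "k \<le> M" using P by (cases P) (auto simp: M_def)
    ultimately have "\<epsilon> * real k \<le> \<epsilon> * real M" by (intro mult_left_mono) auto
    then show "real (N + r) \<le> \<epsilon> * real M" using \<epsilon> by linarith
  qed (use C \<open>0 \<le> \<eta>\<close> in \<open>auto simp: M_def\<close>)
  finally have "\<bar>\<Sum>i<M. h i - T\<bar> \<le> real M * (2 * C * \<epsilon> + \<eta>)" by (simp add: algebra_simps)
  moreover have "0 < k * P" using k P by simp
  then have "0 < M" unfolding M_def by linarith
  then have "0 < real M" by simp
  moreover have "(\<Sum>i<M. h i) / M - T = (\<Sum>i<M. h i - T) / M"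
    using \<open>0 < real M\<close> by (simp add: sum_subtractf diff_divide_distrib)
  ultimately have "\<bar>(\<Sum>i<M. h i) / M - T\<bar> \<le> 2 * C * \<epsilon> + \<eta>"
    by (simp add: divide_le_eq mult.commute)
  then show ?thesis by (simp add: M_def T_def)
qed

section \<open>Choice of the parameters and convergence of the measures\<close>

theorem theoremD:
  fixes a :: real and p :: nat and x :: "nat \<Rightarrow> real"
  assumes "0 < a" and "a \<le> 2"
    and "unstable_periodic_orbit a p x"
    and "critical_orbit_preperiodic_to a p x"
  shows "\<exists>(\<alpha> :: nat \<Rightarrow> real) (q :: nat \<Rightarrow> nat) (y :: nat \<Rightarrow> nat \<Rightarrow> real).
    (\<forall>n. 0 < \<alpha> n \<and> \<alpha> n \<le> 2) \<and>
    \<alpha> \<longlonglongrightarrow> a \<and>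
    (\<forall>n. superstable_attractor (\<alpha> n) (q n) (y n)) \<and>
    weak_star_conv (\<lambda>n. orbit_measure (q n) (y n)) (orbit_measure p x)"
proof -
  define z where "z = x 1"
  have orb: "periodic_orbit a p x" and "\<bar>deriv (quad a ^^ p) z\<bar> > 1"
    using assms(3) by (auto simp: unstable_periodic_orbit_def z_def)
  then have D: "\<bar>dquad a p z\<bar> > 1" using DERIV_imp_deriv[OF DERIV_quad_funpow] by metis
  have p: "1 \<le> p" and xI: "\<And>i. i \<in> {1..p} \<Longrightarrow> x i \<in> I" and last: "quad a (x p) = z"
    and next_pt: "\<And>i. 1 \<le> i \<Longrightarrow> i < p \<Longrightarrow> quad a (x i) = x (Suc i)"
    using orb by (auto simp: periodic_orbit_def z_def)
  have run: "(quad a ^^ k) (x i) = x (i + k)" if "1 \<le> i" "i + k \<le> p" for i k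
    using that by (induction k) (auto simp: next_pt)
  have return: "(quad a ^^ (Suc (p - i))) (x i) = z" if "i \<in> {1..p}" for i
    using run[of i "p - i"] that last by simp
  obtain N0 j where "j \<in> {1..p}" "(quad a ^^ N0) 0 = x j"
    using assms(4) by (auto simp: critical_orbit_preperiodic_to_def)
  \<comment> \<open>The critical orbit may enter the cycle at any \<open>x j\<close>; it is followed
    on to \<open>x 1\<close>, where the multiplier is given.\<close>
  then have hit: "(quad a ^^ (Suc (p - j) + N0)) 0 = z"
    using return[of j] by (simp only: quad_funpow_add)
  define N where "N = Suc (p - j) + N0"
  have per_p: "(quad a ^^ p) z = z" using return[of 1] p by (simp add: z_def)
  text \<open>Doubling the period makes the multiplier positive.\<close>
  interpret preperiodic_critical_orbit a z N "2 * p"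
  proof
    have "1\<^sup>2 < \<bar>dquad a p z\<bar>\<^sup>2" using D by (intro power_strict_mono) auto
    then show "dquad a (2 * p) z > 1" by (simp add: dquad_periodic[OF per_p])
    show "(quad a ^^ (2 * p)) z = z" by (rule quad_funpow_periodic[OF per_p])
  qed (use assms hit p in \<open>auto simp: N_def\<close>)
  have "\<forall>n. \<exists>b k r. 0 < b \<and> b \<le> 2 \<and> \<bar>b - a\<bar> < 1 / Suc n \<and> 1 \<le> k \<and>
    (quad b ^^ (N + k * (2 * p) + r)) 0 = 0 \<and> real (N + r) \<le> 1 / Suc n * real k \<and>
    (\<forall>j<k. \<bar>(quad b ^^ (N + j * (2 * p))) 0 - z\<bar> < 1 / Suc n)"
    by (intro allI critical_return) simp
  then obtain \<alpha> k r where \<alpha>: "\<And>n. 0 < \<alpha> n" "\<And>n. \<alpha> n \<le> 2" "\<And>n. \<bar>\<alpha> n - a\<bar> < 1 / Suc n"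
    and k: "\<And>n. 1 \<le> k n" and zero: "\<And>n. (quad (\<alpha> n) ^^ (N + k n * (2 * p) + r n)) 0 = 0"
    and short: "\<And>n. real (N + r n) \<le> 1 / Suc n * real (k n)"
    and near: "\<And>n j. j < k n \<Longrightarrow> \<bar>(quad (\<alpha> n) ^^ (N + j * (2 * p))) 0 - z\<bar> < 1 / Suc n"
    by metis
  define M where "M n = N + k n * (2 * p) + r n" for n
  have "\<exists>q y. superstable_attractor (\<alpha> n) q y \<and>
    (\<forall>\<phi>::real \<Rightarrow> real. (\<Sum>i=1..q. \<phi> (y i)) / q = (\<Sum>i<M n. \<phi> ((quad (\<alpha> n) ^^ i) 0)) / M n)" for n
    using \<alpha>[of n] zero[of n] by (intro superstable_of_return) (auto simp: M_def N_def less_imp_le)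
  then obtain q y where sup: "\<And>n. superstable_attractor (\<alpha> n) (q n) (y n)"
    and avg: "\<And>n \<phi>. (\<Sum>i=1..q n. \<phi> (y n i)) / q n = (\<Sum>i<M n. \<phi> ((quad (\<alpha> n) ^^ i) 0)) / M n"
    by metis
  have lim0: "(\<lambda>n. 1 / Suc n) \<longlonglongrightarrow> (0::real)" using LIMSEQ_inverse_real_of_nat by (simp add: inverse_eq_divide)
  have lim\<alpha>: "\<alpha> \<longlonglongrightarrow> a"
  proof (rule LIM_zero_cancel, rule Lim_null_comparison[OF _ lim0])
    show "\<forall>\<^sub>F n in sequentially. norm (\<alpha> n - a) \<le> 1 / Suc n"
      using \<alpha>(3) by (intro always_eventually) (simp add: less_imp_le)
  qed
  have "weak_star_conv (\<lambda>n. orbit_measure (q n) (y n)) (orbit_measure p x)"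
    unfolding weak_star_conv_def
  proof (intro allI impI)
    fix \<phi> :: "real \<Rightarrow> real" assume \<phi>: "continuous_on I \<phi>"
    have "compact (\<phi> ` I)" using \<phi> by (intro compact_continuous_image) auto
    then obtain C where C: "\<And>t. t \<in> I \<Longrightarrow> \<bar>\<phi> t\<bar> \<le> C"
      using compact_imp_bounded[of "\<phi> ` I"] by (auto simp: bounded_iff simp del: atLeastAtMost_iff)
    have L: "integral\<^sup>L (orbit_measure p x) \<phi> = (\<Sum>i<2 * p. \<phi> ((quad a ^^ i) z)) / (2 * p)"
    proof -
      have "(\<Sum>i<2 * p. \<phi> ((quad a ^^ i) z)) = 2 * (\<Sum>i<p. \<phi> ((quad a ^^ i) z))"
        using quad_funpow_periodic[OF per_p]
        by (simp add: sum_lessThan_mult quad_funpow_add add.commute[of "_ * p"])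
      also have "(\<Sum>i<p. \<phi> ((quad a ^^ i) z)) = (\<Sum>i<p. \<phi> (x (Suc i)))"
        using run[of 1] by (intro sum.cong) (auto simp: z_def)
      also have "\<dots> = (\<Sum>i=1..p. \<phi> (x i))" by (simp add: sum.atLeast1_atMost_eq)
      finally show ?thesis using integral_orbit_measure[OF p xI \<phi>] by simp
    qed
    have Ln: "integral\<^sup>L (orbit_measure (q n) (y n)) \<phi> = (\<Sum>i<M n. \<phi> ((quad (\<alpha> n) ^^ i) 0)) / M n" for n
      using sup[of n] avg[of \<phi> n] integral_orbit_measure[of "q n" "y n" \<phi>] \<phi>
      by (simp add: superstable_attractor_def periodic_orbit_def)
    show "(\<lambda>n. integral\<^sup>L (orbit_measure (q n) (y n)) \<phi>) \<longlonglongrightarrow> integral\<^sup>L (orbit_measure p x) \<phi>"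
      unfolding L Ln
    proof (rule LIMSEQ_I)
      fix e :: real assume e: "0 < e"
      have "uniformly_continuous_on I \<phi>" using \<phi> by (intro compact_uniformly_continuous) auto
      then obtain d where d: "0 < d" "\<And>s t. s \<in> I \<Longrightarrow> t \<in> I \<Longrightarrow> \<bar>s - t\<bar> < d \<Longrightarrow> \<bar>\<phi> s - \<phi> t\<bar> < e / 2"
        unfolding uniformly_continuous_on_def dist_real_def using e by (meson half_gt_zero)
      have "\<forall>\<^sub>F w in nhds (a, z). \<bar>(quad (fst w) ^^ i) (snd w) - (quad a ^^ i) z\<bar> < d" for i
      proof -
        have "((\<lambda>w. (quad (fst w) ^^ i) (snd w)) \<longlongrightarrow> (quad (fst (a, z)) ^^ i) (snd (a, z))) (nhds (a, z))"
          by (intro tendsto_quad_funpow tendsto_fst tendsto_snd filterlim_ident)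
        from tendstoD[OF this d(1)] show ?thesis by (simp add: dist_real_def)
      qed
      \<comment> \<open>One neighbourhood serves all times of a block, since there are only finitely
        many.\<close>
      then have "\<forall>\<^sub>F w in nhds a \<times>\<^sub>F nhds z. \<forall>i\<in>{..<2 * p}. \<bar>(quad (fst w) ^^ i) (snd w) - (quad a ^^ i) z\<bar> < d"
        unfolding nhds_prod by (intro eventually_ball_finite) auto
      then obtain Pa Pz where ev: "eventually Pa (nhds a)" "eventually Pz (nhds z)"
        and imp: "\<And>b t i. Pa b \<Longrightarrow> Pz t \<Longrightarrow> i < 2 * p \<Longrightarrow> \<bar>(quad b ^^ i) t - (quad a ^^ i) z\<bar> < d"
        unfolding eventually_prod_filter by force
      obtain da where da: "0 < da" "\<And>b. \<bar>b - a\<bar> < da \<Longrightarrow> Pa b"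
        using ev(1) by (auto simp: eventually_nhds_metric dist_real_def)
      obtain dz where dz: "0 < dz" "\<And>t. \<bar>t - z\<bar> < dz \<Longrightarrow> Pz t"
        using ev(2) by (auto simp: eventually_nhds_metric dist_real_def)
      have "(\<lambda>n. 2 * C * (1 / Suc n)) \<longlonglongrightarrow> 2 * C * 0" by (intro tendsto_intros lim0)
      then have "\<forall>\<^sub>F n in sequentially. 2 * C * (1 / Suc n) < e / 2" using e by (intro order_tendstoD) auto
      moreover have "\<forall>\<^sub>F n in sequentially. 1 / Suc n < min da dz"
        using da(1) dz(1) by (intro order_tendstoD(2)[OF lim0]) simp
      ultimately have "\<forall>\<^sub>F n in sequentially. norm ((\<Sum>i<M n. \<phi> ((quad (\<alpha> n) ^^ i) 0)) / M n -
          (\<Sum>i<2 * p. \<phi> ((quad a ^^ i) z)) / (2 * p)) < e"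
      proof eventually_elim
        case (elim n)
        have orbI: "(quad (\<alpha> n) ^^ i) 0 \<in> I" for i
          using \<alpha>(1,2)[of n] by (intro quad_funpow_in_I) auto
        have zI: "(quad a ^^ i) z \<in> I" for i
          using assms(1,2) z_in_I by (intro quad_funpow_in_I) auto
        have "\<bar>\<phi> ((quad (\<alpha> n) ^^ (N + j * (2 * p) + i)) 0) - \<phi> ((quad a ^^ i) z)\<bar> \<le> e / 2"
          if "j < k n" "i < 2 * p" for j i
        proof -
          have "Pa (\<alpha> n)" using \<alpha>(3)[of n] elim by (intro da) simp
          moreover have "Pz ((quad (\<alpha> n) ^^ (N + j * (2 * p))) 0)"
            using near[OF that(1)] elim by (intro dz) simp
          ultimately have "\<bar>(quad (\<alpha> n) ^^ (i + (N + j * (2 * p)))) 0 - (quad a ^^ i) z\<bar> < d"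
            using imp that(2) by (simp only: quad_funpow_add)
          then show ?thesis using d(2) orbI zI by (simp only: add.commute[of _ i] less_imp_le)
        qed
        then have "\<bar>(\<Sum>i<N + k n * (2 * p) + r n. \<phi> ((quad (\<alpha> n) ^^ i) 0)) / (N + k n * (2 * p) + r n) -
            (\<Sum>i<2 * p. \<phi> ((quad a ^^ i) z)) / (2 * p)\<bar> \<le> 2 * C * (1 / Suc n) + e / 2"
          using e p k[of n] short[of n] by (intro average_near_block_average C orbI zI) auto
        then show ?case using elim(1) unfolding M_def real_norm_def by linarith
      qed
      then show "\<exists>no. \<forall>n\<ge>no. norm ((\<Sum>i<M n. \<phi> ((quad (\<alpha> n) ^^ i) 0)) / M n -
          (\<Sum>i<2 * p. \<phi> ((quad a ^^ i) z)) / (2 * p)) < e"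
        by (simp add: eventually_sequentially)
    qed
  qed
  then show ?thesis using \<alpha> lim\<alpha> sup by blast
qed

end
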